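(* Let $f$ and $g$ be transcendental entire functions such that the sets $AV(f\circ g)$ and $AV(g)$ of asymptotic values are bounded. Then the set $AV(f)$ of asymptotic values of $f$ is also bounded.
   Context: For an entire function $h$, a point $\zeta\in\mathbb{C}$ is an asymptotic value of $h$ if there exists a curve $\Gamma$ tending to infinity such that $h(z)\to\zeta$ as $z\to\infty$ along $\Gamma$. $AV(h)\subset\mathbb{C}$ denotes the set of all asymptotic values of $h$ (only finite values are counted). *)

theory Defs
  imports "HOL-Complex_Analysis.Complex_Analysis" "HOL-Computational_Algebra.Polynomial"
begin

definition transcendental_entire :: "(complex \<Rightarrow> complex) \<Rightarrow> bool" where
  "transcendental_entire f \<longleftrightarrow>
     f holomorphic_on UNIV \<and> \<not> (\<exists>p :: complex poly. \<forall>z. f z = poly p z)"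

(* A curve tending to infinity is a continuous map of the half-line [0, \<infinity>) into the plane
   that leaves every bounded set as the parameter tends to infinity; the values of the
   function \<gamma> at negative parameters are irrelevant. *)
definition curve_to_infinity :: "(real \<Rightarrow> complex) \<Rightarrow> bool" where
  "curve_to_infinity \<gamma> \<longleftrightarrow> continuous_on {0..} \<gamma> \<and> filterlim \<gamma> at_infinity at_top"

definition asymptotic_value :: "(complex \<Rightarrow> complex) \<Rightarrow> complex \<Rightarrow> bool" where
  "asymptotic_value h \<zeta> \<longleftrightarrow>
     (\<exists>\<gamma>. curve_to_infinity \<gamma> \<and> ((\<lambda>t. h (\<gamma> t)) \<longlongrightarrow> \<zeta>) at_top)"

definition AV :: "(complex \<Rightarrow> complex) \<Rightarrow> complex set" where
  "AV h = {\<zeta>. asymptotic_value h \<zeta>}"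

end

theory Submission
  imports Defs
begin

text \<open>
  In fact \<open>AV f \<subseteq> AV (f \<circ> g)\<close>. If \<open>f\<close> tends to \<open>\<zeta>\<close> along \<open>\<Gamma>\<close>, then a tail of \<open>\<Gamma>\<close> avoids the
  bounded set \<open>AV g\<close> and, by Picard, can be taken to start in the range of \<open>g\<close>. Such a tail
  lifts to a curve \<open>\<gamma>\<close> with \<open>g \<circ> \<gamma> = \<Gamma>\<close>: near a point of multiplicity \<open>n\<close> the map \<open>g\<close> is an
  \<open>n\<close>-th power in suitable coordinates, and \<open>n\<close>-th roots of continuous paths exist, so a lift
  through critical points can always be continued (not uniquely); a lift that stops at a finite
  parameter \<open>T\<close> would have to tend to infinity there, and \<open>\<Gamma> T\<close> would be an asymptotic value of
  \<open>g\<close>. Since \<open>g\<close> is bounded on bounded sets, \<open>\<gamma>\<close> tends to infinity, and \<open>f \<circ> g\<close> tends to \<open>\<zeta>\<close>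
  along it.
\<close>

section \<open>Roots of continuous paths and local lifting through critical points\<close>

text \<open>Where \<open>p\<close> does not vanish, each component is an interval and carries a
  continuous logarithm, which is divided by \<open>n\<close>. The branches on different components
  need not match: at a zero of \<open>p\<close> every choice of roots is continuous, because its
  modulus is \<open>root n (norm (p t))\<close>, which tends to 0 there.\<close>

lemma continuous_nth_root_real:
  fixes p :: "real \<Rightarrow> complex"
  assumes cont: "continuous_on UNIV p" and n: "n > 0"
  obtains q where "continuous_on UNIV q" "\<And>t. q t ^ n = p t"
proof -
  define S where "S = {t. p t \<noteq> 0}"
  have "open S"
    unfolding S_def using cont by (intro open_Collect_neq continuous_intros)
  have "\<exists>L. continuous_on C L \<and> (\<forall>t\<in>C. p t = exp (L t))" if C: "C \<in> components S" for C
  proof -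
    have "convex C"
      using C in_components_connected is_interval_connected_1 is_interval_convex_1 by blast
    moreover have "p t \<noteq> 0" if "t \<in> C" for t
      using in_components_subset[OF C] that by (auto simp: S_def)
    ultimately show ?thesis
      using continuous_logarithm_on_contractible[of C p] cont continuous_on_subset
        convex_imp_contractible by (metis subset_UNIV)
  qed
  then obtain L where L: "\<And>C. C \<in> components S \<Longrightarrow> continuous_on C (L C)"
      "\<And>C t. C \<in> components S \<Longrightarrow> t \<in> C \<Longrightarrow> p t = exp (L C t)"
    by metis
  \<comment> \<open>The logarithm is indexed by the component of \<open>t\<close>, so one branch is
    used throughout each component.\<close>
  define K where "K = connected_component_set S"
  have K: "K t \<in> components S" "t \<in> K t" if "t \<in> S" for t
    using that by (auto simp: K_def components_def)
  have K_eq: "K s = K t" if "s \<in> K t" for s t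
    using that unfolding K_def by (metis connected_component_eq)
  define q where "q t = (if t \<in> S then exp (L (K t) t / of_nat n) else 0)" for t
  have q: "q t ^ n = p t" for t
  proof (cases "t \<in> S")
    case True
    then show ?thesis using L(2)[of "K t" t] K[of t] n by (simp add: q_def exp_divide_power_eq)
  next
    case False
    then show ?thesis using n by (simp add: q_def S_def)
  qed
  have "isCont q t" for t
  proof (cases "t \<in> S")
    case True
    have op: "open (K t)"
      using \<open>open S\<close> by (simp add: K_def open_connected_component)
    have sub: "K t \<subseteq> S"
      by (simp add: K_def connected_component_subset)
    have "continuous_on (K t) (\<lambda>s. exp (L (K t) s / of_nat n))"
      using n L(1)[OF K(1)[OF True]] by (intro continuous_intros) auto
    then have "continuous_on (K t) q"
      by (rule continuous_on_eq) (use sub K_eq in \<open>auto simp: q_def\<close>)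
    then show ?thesis
      using op K(2)[OF True] continuous_on_eq_continuous_at by blast
  next
    case False
    then have "p t = 0" "q t = 0" by (auto simp: S_def q_def)
    have "norm (q s) = root n (norm (p s))" for s
      using n by (simp add: norm_power real_root_pos2 flip: q)
    moreover have "((\<lambda>s. root n (norm (p s))) \<longlongrightarrow> root n (norm (p t))) (at t)"
      using cont by (intro tendsto_intros) (simp add: continuous_on_def)
    ultimately have "((\<lambda>s. norm (q s)) \<longlongrightarrow> 0) (at t)"
      using \<open>p t = 0\<close> by simp
    then show ?thesis
      using \<open>q t = 0\<close> by (simp add: isCont_def tendsto_norm_zero_iff)
  qed
  then have "continuous_on UNIV q"
    by (simp add: continuous_at_imp_continuous_on)
  with q show thesis using that by blast
qed

text \<open>If \<open>n\<close> is the multiplicity of \<open>g\<close> at \<open>z0\<close>, then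
  \<open>g w - g z0 = h w ^ n\<close> near \<open>z0\<close> with \<open>h\<close> locally
  biholomorphic. Applying the local inverse of \<open>h\<close> to a continuous \<open>n\<close>-th
  root of \<open>p - g z0\<close> gives the lift.\<close>

lemma holomorphic_local_path_lift:
  assumes holg: "g holomorphic_on S" "open S" "connected S" "z0 \<in> S"
    and nonconst: "\<not> g constant_on S"
    and p: "continuous_on {a..} p" "p (a :: real) = g z0"
  obtains b \<gamma> where "a < b" "continuous_on {a..b} \<gamma>" "\<gamma> a = z0"
    "\<And>t. t \<in> {a..b} \<Longrightarrow> g (\<gamma> t) = p t"
proof -
  define n where "n = (LEAST n. 0 < n \<and> (deriv ^^ n) g z0 \<noteq> 0)"
  obtain n0 where "0 < n0" "(deriv ^^ n0) g z0 \<noteq> 0"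
    using nonconst holomorphic_fun_eq_const_on_connected[OF holg(1-3)] holg(4)
    unfolding constant_on_def by metis
  then have n: "0 < n" "(deriv ^^ n) g z0 \<noteq> 0"
    unfolding n_def by (metis (mono_tags, lifting) LeastI)+
  have "\<And>k. \<lbrakk>0 < k; k < n\<rbrakk> \<Longrightarrow> (deriv ^^ k) g z0 = 0"
    unfolding n_def by (blast dest: not_less_Least)
  then obtain G r where "0 < r" and holG: "G holomorphic_on ball z0 r"
      and G: "\<And>w. w \<in> ball z0 r \<Longrightarrow> g w - g z0 = ((w - z0) * G w) ^ n"
      and Gnz: "\<And>w. w \<in> ball z0 r \<Longrightarrow> G w \<noteq> 0"
    by (blast intro: holomorphic_factor_order_of_zero_strong[OF holg(1,2,4) n])
  define h where "h w = (w - z0) * G w" for w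
  have holh: "h holomorphic_on ball z0 r"
    unfolding h_def using holG by (intro holomorphic_intros)
  have "(G has_field_derivative deriv G z0) (at z0)"
    using holG \<open>0 < r\<close> by (meson centre_in_ball holomorphic_derivI open_ball)
  then have "(h has_field_derivative G z0) (at z0)"
    unfolding h_def by (auto intro!: derivative_eq_intros)
  then have "deriv h z0 \<noteq> 0"
    using Gnz \<open>0 < r\<close> by (simp add: DERIV_imp_deriv)
  then obtain \<rho> where \<rho>: "\<rho> > 0" "ball z0 \<rho> \<subseteq> ball z0 r" "open (h ` ball z0 \<rho>)" "inj_on h (ball z0 \<rho>)"
    using has_complex_derivative_locally_invertible[OF holh] \<open>0 < r\<close> by (metis centre_in_ball open_ball)
  obtain \<psi> where \<psi>: "\<psi> holomorphic_on (h ` ball z0 \<rho>)" "\<And>z. z \<in> ball z0 \<rho> \<Longrightarrow> \<psi> (h z) = z"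
    using holomorphic_has_inverse[OF holomorphic_on_subset[OF holh \<rho>(2)] open_ball \<rho>(4)] by metis
  \<comment> \<open>The path is frozen at its initial value to the left of \<open>a\<close>, so that
    it is defined on the whole line and has a root there.\<close>
  have "continuous_on UNIV (\<lambda>t. p (max a t) - g z0)"
    by (intro continuous_intros continuous_on_compose2[OF p(1)]) auto
  then obtain q where q: "continuous_on UNIV q" "\<And>t. q t ^ n = p (max a t) - g z0"
    using continuous_nth_root_real n(1) by blast
  have h0: "h z0 = 0" by (simp add: h_def)
  \<comment> \<open>Whatever branch was chosen, the root vanishes at \<open>a\<close>; hence the
    lift starts at \<open>z0\<close>.\<close>
  have qa: "q a = 0" using q(2)[of a] p(2) n(1) by simp
  have "open (q -` (h ` ball z0 \<rho>))"
    by (rule open_vimage[OF \<rho>(3) q(1)])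
  moreover have "a \<in> q -` (h ` ball z0 \<rho>)"
    using qa h0 \<open>\<rho> > 0\<close> by (metis centre_in_ball image_eqI vimageI)
  ultimately obtain d where d: "d > 0" "cball a d \<subseteq> q -` (h ` ball z0 \<rho>)"
    using open_contains_cball by blast
  have qim: "q t \<in> h ` ball z0 \<rho>" if "t \<in> {a..a+d}" for t
    using d(2) that by (auto simp: dist_real_def subset_iff)
  show thesis
  proof
    show "a < a + d" using d by simp
    show "continuous_on {a..a+d} (\<lambda>t. \<psi> (q t))"
      using qim
      by (intro continuous_on_compose2[OF holomorphic_on_imp_continuous_on[OF \<psi>(1)]]
          continuous_on_subset[OF q(1)]) auto
    show "\<psi> (q a) = z0"
      using \<psi>(2)[of z0] qa h0 \<open>\<rho> > 0\<close> by simp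
    show "g (\<psi> (q t)) = p t" if t: "t \<in> {a..a+d}" for t
    proof -
      obtain w where w: "w \<in> ball z0 \<rho>" "q t = h w" using qim[OF t] by blast
      then have "g w - g z0 = q t ^ n" using G[of w] \<rho>(2) by (auto simp: h_def)
      then show ?thesis using w \<psi>(2) q(2)[of t] t by (simp add: max_def)
    qed
  qed
qed

section \<open>Behaviour of a lift at a finite end of its interval\<close>

text \<open>Otherwise each point of \<open>K\<close> has a neighbourhood that \<open>f\<close>
  eventually avoids; finitely many of these cover \<open>K\<close>, so \<open>f\<close> would
  eventually avoid \<open>K\<close>.\<close>

lemma frequently_compact_cluster_point:
  assumes "compact K" and freq: "frequently (\<lambda>t. f t \<in> K) F"
  obtains z where "z \<in> K" "\<And>U. open U \<Longrightarrow> z \<in> U \<Longrightarrow> frequently (\<lambda>t. f t \<in> U) F"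
proof (rule ccontr)
  assume "\<not> thesis"
  then have "\<forall>z\<in>K. \<exists>U. open U \<and> z \<in> U \<and> eventually (\<lambda>t. f t \<notin> U) F"
    using that unfolding frequently_def by blast
  then obtain U where U: "\<And>z. z \<in> K \<Longrightarrow> open (U z)" "\<And>z. z \<in> K \<Longrightarrow> z \<in> U z"
      "\<And>z. z \<in> K \<Longrightarrow> eventually (\<lambda>t. f t \<notin> U z) F"
    by metis
  obtain K' where K': "K' \<subseteq> K" "finite K'" "K \<subseteq> (\<Union>z\<in>K'. U z)"
    using compactE_image[OF \<open>compact K\<close>, of K U] U(1,2) by blast
  then have "eventually (\<lambda>t. \<forall>z\<in>K'. f t \<notin> U z) F"
    using U(3) by (intro eventually_ball_finite) auto
  then have "eventually (\<lambda>t. f t \<notin> K) F"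
    by eventually_elim (use K'(3) in blast)
  with freq show False by (simp add: frequently_def)
qed

text \<open>Were \<gamma> to tend to infinity, \<open>w\<close> would be an asymptotic value. So
  \<gamma> has a finite cluster point \<open>z\<close>, and \<open>g z = w\<close> by continuity.
  Solutions of \<open>g u = w\<close> are isolated, so on a small circle about \<open>z\<close> the
  distance from \<open>g\<close> to \<open>w\<close> is bounded below; near \<open>T\<close> the
  curve cannot cross that circle and is trapped inside.\<close>

lemma lift_converges_at_left:
  fixes a T :: real
  assumes holg: "g holomorphic_on UNIV" and nonconst: "\<not> g constant_on UNIV"
    and "a < T" and cont: "continuous_on {a..<T} \<gamma>"
    and lim: "((\<lambda>t. g (\<gamma> t)) \<longlongrightarrow> w) (at_left T)"
    and nAV: "w \<notin> AV g"
  obtains z where "(\<gamma> \<longlongrightarrow> z) (at_left T)" "g z = w"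
proof -
  have "\<not> filterlim \<gamma> at_infinity (at_left T)"
  proof
    assume inf: "filterlim \<gamma> at_infinity (at_left T)"
    \<comment> \<open>An increasing reparametrisation of \<open>{a..<T}\<close> by the half-line,
      with \<open>\<phi> 0 = a\<close>, as \<open>curve_to_infinity\<close> requires.\<close>
    define \<phi> where "\<phi> s = T - (T - a) / (1 + s)" for s
    have ev: "\<phi> s \<in> {a..<T}" if "s \<ge> 0" for s
    proof -
      have "(T - a) / (1 + s) \<le> (T - a) / 1"
        using that \<open>a < T\<close> by (intro divide_left_mono) auto
      moreover have "(T - a) / (1 + s) > 0" using that \<open>a < T\<close> by simp
      ultimately show ?thesis by (simp add: \<phi>_def)
    qed
    have "((\<lambda>s. (T - a) / (1 + s)) \<longlongrightarrow> 0) at_top"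
      by (rule real_tendsto_divide_at_top[OF tendsto_const
            filterlim_tendsto_add_at_top[OF tendsto_const filterlim_ident]])
    then have "(\<phi> \<longlongrightarrow> T) at_top"
      unfolding \<phi>_def using tendsto_diff[OF tendsto_const] by fastforce
    moreover have "eventually (\<lambda>s. \<phi> s \<in> {..<T} - {T}) at_top"
      using eventually_ge_at_top[of 0] by eventually_elim (use ev in auto)
    ultimately have \<phi>: "filterlim \<phi> (at_left T) at_top"
      by (auto simp: filterlim_at elim: eventually_mono)
    have "continuous_on {0..} \<phi>"
      unfolding \<phi>_def by (intro continuous_intros) auto
    then have "continuous_on {0..} (\<lambda>s. \<gamma> (\<phi> s))"
      using ev by (intro continuous_on_compose2[OF cont]) auto
    then have "curve_to_infinity (\<lambda>s. \<gamma> (\<phi> s))"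
      unfolding curve_to_infinity_def using filterlim_compose[OF inf \<phi>] by blast
    moreover have "((\<lambda>s. g (\<gamma> (\<phi> s))) \<longlongrightarrow> w) at_top"
      using filterlim_compose[OF lim \<phi>] by simp
    ultimately show False
      using nAV by (auto simp: AV_def asymptotic_value_def)
  qed
  then obtain r where "frequently (\<lambda>t. \<gamma> t \<in> cball 0 r) (at_left T)"
    by (auto simp: filterlim_at_infinity[OF order_refl] frequently_def not_le
        intro: eventually_mono less_imp_le)
  then obtain z where z: "\<And>U. open U \<Longrightarrow> z \<in> U \<Longrightarrow> frequently (\<lambda>t. \<gamma> t \<in> U) (at_left T)"
    using frequently_compact_cluster_point compact_cball by blast
  have contg: "continuous_on UNIV g"
    using holg holomorphic_on_imp_continuous_on by blast
  have gz: "g z = w"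
  proof (rule ccontr)
    assume "g z \<noteq> w"
    then obtain A B where AB: "open A" "open B" "g z \<in> A" "w \<in> B" "A \<inter> B = {}"
      using hausdorff by metis
    have "frequently (\<lambda>t. \<gamma> t \<in> g -` A) (at_left T)"
      using z[of "g -` A"] AB contg by (simp add: open_vimage)
    moreover have "eventually (\<lambda>t. \<gamma> t \<notin> g -` A) (at_left T)"
      using topological_tendstoD[OF lim AB(2,4)] by eventually_elim (use AB(5) in auto)
    ultimately show False by (simp add: frequently_def)
  qed
  \<comment> \<open>The point \<beta> shows that \<open>g - w\<close> is not identically zero, which
    makes its zero at \<open>z\<close> isolated.\<close>
  obtain \<beta> where "g \<beta> \<noteq> w"
    using nonconst unfolding constant_on_def by blast
  then have "g \<beta> - w \<noteq> 0" by simp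
  moreover have "(\<lambda>u. g u - w) holomorphic_on UNIV"
    by (intro holomorphic_intros holg)
  moreover have "g z - w = 0" using gz by simp
  ultimately obtain r where r: "0 < r" "\<And>u. u \<in> ball z r - {z} \<Longrightarrow> g u - w \<noteq> 0"
    using isolated_zeros[OF _ open_UNIV connected_UNIV UNIV_I _ UNIV_I] by (metis (no_types, lifting))
  have "(\<gamma> \<longlongrightarrow> z) (at_left T)"
  proof (rule tendstoI)
    fix e :: real assume "e > 0"
    \<comment> \<open>Half of \<open>r\<close> keeps the circle of radius \<open>d\<close> inside
      the punctured disc where \<open>g\<close> differs from \<open>w\<close>;
      \<open>d \<le> e\<close> turns trapping in the disc into the required estimate.\<close>
    define d where "d = min e (r / 2)"
    have d: "0 < d" "d \<le> e" "d < r" using \<open>e > 0\<close> r(1) by (auto simp: d_def)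
    have "continuous_on (sphere z d) (\<lambda>u. norm (g u - w))"
      using contg by (intro continuous_intros) (auto intro: continuous_on_subset)
    then obtain u0 where u0: "u0 \<in> sphere z d" "\<And>u. u \<in> sphere z d \<Longrightarrow> norm (g u0 - w) \<le> norm (g u - w)"
      using continuous_attains_inf[of "sphere z d" "\<lambda>u. norm (g u - w)"] d(1) by force
    have "norm (g u0 - w) > 0"
      using r(2)[of u0] u0(1) d by auto
    then have "eventually (\<lambda>t. dist (g (\<gamma> t)) w < norm (g u0 - w)) (at_left T)"
      using tendstoD[OF lim] by blast
    then obtain t0 where t0: "t0 < T" "\<And>t. t0 < t \<Longrightarrow> t < T \<Longrightarrow> norm (g (\<gamma> t) - w) < norm (g u0 - w)"
      unfolding eventually_at_left_field dist_norm by blast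
    \<comment> \<open>After \<open>t0\<close> the value of \<open>g\<close> along \<gamma> is closer
      to \<open>w\<close> than its minimal distance on the circle, so \<gamma> is never on the
      circle.\<close>
    have off: "dist z (\<gamma> t) \<noteq> d" if "t0 < t" "t < T" for t
      using t0(2)[OF that] u0(2)[of "\<gamma> t"] by auto
    have "frequently (\<lambda>t. \<gamma> t \<in> ball z d) (at_left T)"
      by (rule z) (use d(1) in auto)
    moreover have "eventually (\<lambda>t. t \<in> {max a t0<..<T}) (at_left T)"
      using t0(1) \<open>a < T\<close> by (intro eventually_at_leftI[of "max a t0"]) auto
    ultimately obtain t1 where t1: "t1 \<in> {max a t0<..<T}" "\<gamma> t1 \<in> ball z d"
      unfolding frequently_def by (metis (mono_tags, lifting) eventually_mono)
    \<comment> \<open>Starting inside at \<open>t1\<close>, the curve could leave only by meeting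
      the circle, by the intermediate value theorem.\<close>
    have "dist z (\<gamma> t) < d" if t: "t1 < t" "t < T" for t
    proof (rule ccontr)
      assume "\<not> dist z (\<gamma> t) < d"
      moreover have "continuous_on {t1..t} (\<lambda>s. dist z (\<gamma> s))"
        using t t1(1) by (intro continuous_intros continuous_on_subset[OF cont]) auto
      ultimately obtain s where "t1 \<le> s" "s \<le> t" "dist z (\<gamma> s) = d"
        using IVT'[of "\<lambda>s. dist z (\<gamma> s)" t1 d t] t t1(2) by auto
      then show False using off[of s] t t1(1) by auto
    qed
    then show "eventually (\<lambda>t. dist (\<gamma> t) z < e) (at_left T)"
      unfolding eventually_at_left_field
      using t1(1) d(2) by (metis dist_commute greaterThanLessThan_iff order.strict_trans2)
  qed
  with gz that show thesis by blast
qed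


section \<open>Partial lifts and global path lifting by Zorn's lemma\<close>

text \<open>The third and fourth conditions make the domain \<open>D\<close> relatively open and downward closed in
  \<open>{a..}\<close>; relative openness makes continuity survive unions of chains.\<close>

definition partial_lift ::
    "(complex \<Rightarrow> complex) \<Rightarrow> (real \<Rightarrow> complex) \<Rightarrow> real \<Rightarrow> complex \<Rightarrow> real set \<Rightarrow> (real \<Rightarrow> complex) \<Rightarrow> bool"
  where "partial_lift g p a z0 D \<gamma> \<longleftrightarrow>
    a \<in> D \<and> D \<subseteq> {a..} \<and> (\<forall>t\<in>D. {a..t} \<subseteq> D) \<and> (\<forall>t\<in>D. \<exists>s\<in>D. t < s) \<and>
    continuous_on D \<gamma> \<and> \<gamma> a = z0 \<and> (\<forall>t\<in>D. g (\<gamma> t) = p t)"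

lemma partial_lift_atLeastLessThan:
  assumes "a < b" "continuous_on {a..<b} \<gamma>" "\<gamma> a = z0" "\<And>t. t \<in> {a..<b} \<Longrightarrow> g (\<gamma> t) = p t"
  shows "partial_lift g p a z0 {a..<b} \<gamma>"
proof -
  have "\<exists>s\<in>{a..<b}. t < s" if "t \<in> {a..<b}" for t
    by (rule bexI[of _ "(t + b) / 2"]) (use that in auto)
  with assms show ?thesis by (auto simp: partial_lift_def)
qed

text \<open>A missing parameter bounds \<open>D\<close> above, since \<open>D\<close> is downward
  closed; having no greatest element, \<open>D\<close> stops just short of its supremum.\<close>

lemma partial_lift_domain:
  assumes "partial_lift g p a z0 D \<gamma>" and "D \<noteq> {a..}"
  obtains T where "a < T" "D = {a..<T}"
proof -
  have D: "a \<in> D" "D \<subseteq> {a..}" "\<And>t. t \<in> D \<Longrightarrow> {a..t} \<subseteq> D" "\<And>t. t \<in> D \<Longrightarrow> \<exists>s\<in>D. t < s"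
    using assms(1) by (auto simp: partial_lift_def)
  obtain u where u: "u \<ge> a" "u \<notin> D" using assms(2) D(2) by auto
  have le: "t \<le> u" if "t \<in> D" for t
    using D(3)[OF that] u by force
  then have bdd: "bdd_above D" by (auto simp: bdd_above_def)
  have lt: "t < Sup D" if "t \<in> D" for t
    using D(4)[OF that] cSup_upper[OF _ bdd] by force
  have "t \<in> D" if "a \<le> t" "t < Sup D" for t
    using that D(1,3) less_cSup_iff[of D t] bdd by fastforce
  then have "D = {a..<Sup D}"
    using lt D(2) by (auto simp: subset_iff)
  then show thesis using that lt[OF D(1)] by blast
qed

text \<open>The chain condition for Zorn's lemma. Lifts are encoded as graphs over their domains, so
  inclusion means extension and values outside the domain are forgotten.\<close>

lemma partial_lift_Union:
  assumes ne: "\<C> \<noteq> {}" and chain: "subset.chain {(\<lambda>t. (t, \<gamma> t)) ` D |D \<gamma>. partial_lift g p a z0 D \<gamma>} \<C>"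
  shows "\<Union>\<C> \<in> {(\<lambda>t. (t, \<gamma> t)) ` D |D \<gamma>. partial_lift g p a z0 D \<gamma>}"
proof -
  have "\<forall>G\<in>\<C>. \<exists>D \<gamma>. partial_lift g p a z0 D \<gamma> \<and> G = (\<lambda>t. (t, \<gamma> t)) ` D"
    using chain unfolding subset.chain_def by blast
  then obtain D \<gamma> where D: "\<And>G. G \<in> \<C> \<Longrightarrow> partial_lift g p a z0 (D G) (\<gamma> G)"
      "\<And>G. G \<in> \<C> \<Longrightarrow> G = (\<lambda>t. (t, \<gamma> G t)) ` D G"
    by metis
  define E where "E = (\<Union>G\<in>\<C>. D G)"
  have val: "z = \<gamma> G t" if "G \<in> \<C>" "(t, z) \<in> G" for G t z
    using D(2)[OF that(1)] that(2) by blast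
  have agree: "\<gamma> G t = \<gamma> H t" if GH: "G \<in> \<C>" "H \<in> \<C>" and t: "t \<in> D G" "t \<in> D H" for G H t
  proof -
    have "G \<subseteq> H \<or> H \<subseteq> G"
      using bspec[OF bspec[OF conjunct2[OF chain[unfolded subset_chain_def]] GH(1)] GH(2)] .
    moreover have "(t, \<gamma> G t) \<in> G" "(t, \<gamma> H t) \<in> H"
      using D(2)[OF GH(1)] D(2)[OF GH(2)] t by blast+
    ultimately show ?thesis using val[OF GH(1)] val[OF GH(2)] by (metis subsetD)
  qed
  \<comment> \<open>Any member of the chain defined at \<open>t\<close> may be chosen, since by
    \<open>agree\<close> they all give the same value.\<close>
  define \<delta> where "\<delta> t = \<gamma> (SOME G. G \<in> \<C> \<and> t \<in> D G) t" for t
  have \<delta>: "\<delta> t = \<gamma> G t" if "G \<in> \<C>" "t \<in> D G" for G t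
  proof -
    let ?P = "\<lambda>G. G \<in> \<C> \<and> t \<in> D G"
    have "?P (SOME G. ?P G)"
      by (rule someI[of ?P G]) (simp add: that)
    then show ?thesis
      unfolding \<delta>_def by (elim conjE) (rule agree[OF _ that(1) _ that(2)])
  qed
  have "continuous (at t within E) \<delta>" if t: "t \<in> E" for t
  proof -
    obtain G where G: "G \<in> \<C>" "t \<in> D G" using t unfolding E_def by blast
    obtain s where s: "s \<in> D G" "t < s" using D(1)[OF G(1)] G(2) by (auto simp: partial_lift_def)
    have sub: "{a..s} \<subseteq> D G" using D(1)[OF G(1)] s(1) by (auto simp: partial_lift_def)
    have "E \<subseteq> {a..}" using D(1) by (fastforce simp: E_def partial_lift_def)
    \<comment> \<open>Because \<open>D G\<close> reaches beyond \<open>t\<close> to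
      \<open>s\<close>, it coincides with \<open>E\<close> below \<open>s\<close>. Continuity at
      \<open>t\<close> within \<open>E\<close> thus reduces to continuity within one member.\<close>
    then have "E \<inter> {..<s} \<subseteq> D G" using sub by fastforce
    moreover have "D G \<subseteq> E" using G(1) by (auto simp: E_def)
    ultimately have "E \<inter> {..<s} - {t} = D G \<inter> {..<s} - {t}" by blast
    then have at: "at t within E = at t within D G"
      by (intro at_within_nhd[of t "{..<s}"]) (use s in auto)
    have "continuous_on (D G) \<delta>"
      using D(1)[OF G(1)] \<delta>[OF G(1)] continuous_on_eq unfolding partial_lift_def by metis
    then show ?thesis using G(2) at by (simp add: continuous_on_eq_continuous_within)
  qed
  then have "continuous_on E \<delta>" by (simp add: continuous_on_eq_continuous_within)
  moreover obtain G0 where G0: "G0 \<in> \<C>" using ne by blast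
  have "a \<in> D G0" "\<gamma> G0 a = z0" using D(1)[OF G0] by (auto simp: partial_lift_def)
  then have "a \<in> E" "\<delta> a = z0" using G0 \<delta> by (auto simp: E_def)
  moreover have "D G \<subseteq> {a..} \<and> (\<forall>t\<in>D G. {a..t} \<subseteq> D G) \<and> (\<forall>t\<in>D G. \<exists>s\<in>D G. t < s)
      \<and> (\<forall>t\<in>D G. g (\<delta> t) = p t)" if "G \<in> \<C>" for G
    using D(1)[OF that] \<delta>[OF that] by (simp add: partial_lift_def)
  then have "E \<subseteq> {a..}" "\<forall>t\<in>E. {a..t} \<subseteq> E" "\<forall>t\<in>E. \<exists>s\<in>E. t < s" "\<forall>t\<in>E. g (\<delta> t) = p t"
    unfolding E_def by fast+
  ultimately have "partial_lift g p a z0 E \<delta>" by (simp add: partial_lift_def)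
  moreover have "(\<lambda>t. (t, \<delta> t)) ` E = (\<Union>G\<in>\<C>. (\<lambda>t. (t, \<gamma> G t)) ` D G)"
    using \<delta> by (force simp: E_def)
  then have "\<Union>\<C> = (\<lambda>t. (t, \<delta> t)) ` E" using D(2) by auto
  ultimately show ?thesis by blast
qed

text \<open>Lifts through critical points are not unique, so local lifts cannot simply be glued; a
  maximal one is taken instead. If it stopped at a finite \<open>T\<close>, it would converge there
  to some \<open>z\<close> with \<open>g z = p T\<close>, and a local lift from \<open>z\<close>
  would extend it.\<close>

theorem entire_path_lift:
  assumes holg: "g holomorphic_on UNIV" and nonconst: "\<not> g constant_on UNIV"
    and p: "continuous_on {a..} p" "p (a :: real) = g z0"
    and nAV: "\<And>t. t \<ge> a \<Longrightarrow> p t \<notin> AV g"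
  obtains \<gamma> where "continuous_on {a..} \<gamma>" "\<gamma> a = z0" "\<And>t. t \<ge> a \<Longrightarrow> g (\<gamma> t) = p t"
proof -
  let ?A = "{(\<lambda>t. (t, \<gamma> t)) ` D |D \<gamma>. partial_lift g p a z0 D \<gamma>}"
  obtain b0 \<gamma>0 where 0: "a < b0" "continuous_on {a..b0} \<gamma>0" "\<gamma>0 a = z0"
      "\<And>t. t \<in> {a..b0} \<Longrightarrow> g (\<gamma>0 t) = p t"
    using holomorphic_local_path_lift[OF holg open_UNIV connected_UNIV UNIV_I nonconst p] by metis
  have "partial_lift g p a z0 {a..<b0} \<gamma>0"
    using 0 by (intro partial_lift_atLeastLessThan continuous_on_subset[OF 0(2)]) auto
  then have "?A \<noteq> {}" by blast
  then obtain M where M: "M \<in> ?A" "\<And>X. X \<in> ?A \<Longrightarrow> M \<subseteq> X \<Longrightarrow> X = M"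
    using subset_Zorn_nonempty[of ?A] partial_lift_Union by (metis (lifting))
  then obtain D \<gamma> where D: "partial_lift g p a z0 D \<gamma>" and M_eq: "M = (\<lambda>t. (t, \<gamma> t)) ` D"
    by blast
  have "D = {a..}"
  proof (rule ccontr)
    assume "D \<noteq> {a..}"
    with D obtain T where T: "a < T" "D = {a..<T}" by (rule partial_lift_domain)
    have \<gamma>: "continuous_on {a..<T} \<gamma>" "\<gamma> a = z0" "\<And>t. t \<in> {a..<T} \<Longrightarrow> g (\<gamma> t) = p t"
      using D T(2) by (auto simp: partial_lift_def)
    have "isCont p T"
      using continuous_on_interior[OF p(1)] T(1) by simp
    then have "(p \<longlongrightarrow> p T) (at_left T)"
      unfolding isCont_def by (rule filterlim_mono) (auto simp: at_le)
    moreover have "eventually (\<lambda>t. g (\<gamma> t) = p t) (at_left T)"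
      using T(1) \<gamma>(3) by (intro eventually_at_leftI[of a]) auto
    ultimately have "((\<lambda>t. g (\<gamma> t)) \<longlongrightarrow> p T) (at_left T)"
      by (simp add: filterlim_cong)
    then obtain z where z: "(\<gamma> \<longlongrightarrow> z) (at_left T)" "g z = p T"
      using lift_converges_at_left[OF holg nonconst T(1) \<gamma>(1)] nAV[of T] T(1) by auto
    have "continuous_on {T..} p" using p(1) T(1) by (auto intro: continuous_on_subset)
    then obtain b \<delta> where \<delta>: "T < b" "continuous_on {T..b} \<delta>" "\<delta> T = z"
        "\<And>t. t \<in> {T..b} \<Longrightarrow> g (\<delta> t) = p t"
      using holomorphic_local_path_lift[OF holg open_UNIV connected_UNIV UNIV_I nonconst] z(2) by metis
    \<comment> \<open>Since \<open>T\<close> is outside the domain, the value of \<gamma> there is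
      arbitrary; it is replaced by the limit \<open>z\<close>, where \<delta> begins.\<close>
    define \<eta> where "\<eta> t = (if t \<le> T then (\<gamma>(T := z)) t else \<delta> t)" for t
    have "continuous (at t within {a..T}) (\<gamma>(T := z))" if t: "t \<in> {a..T}" for t
    proof (cases "t = T")
      case True
      have "at T within {a..T} = at_left T"
        using T(1) by (intro at_within_nhd[of T "{a<..}"]) auto
      moreover have "((\<gamma>(T := z)) \<longlongrightarrow> z) (at_left T)"
        using z(1) by (rule Lim_transform_eventually) (auto simp: eventually_at_filter)
      ultimately show ?thesis using True by (simp add: continuous_within)
    next
      case False
      then have "at t within {a..T} = at t within {a..<T}"
        using t by (intro at_within_nhd[of t "{..<T}"]) auto
      moreover have "continuous (at t within {a..<T}) \<gamma>"
        using \<gamma>(1) t False by (simp add: continuous_on_eq_continuous_within)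
      moreover have "eventually (\<lambda>s. \<gamma> s = (\<gamma>(T := z)) s) (at t within {a..<T})"
        by (auto simp: eventually_at_filter)
      ultimately show ?thesis
        using False by (auto simp: continuous_within elim: Lim_transform_eventually)
    qed
    then have "continuous_on {a..T} (\<gamma>(T := z))"
      unfolding continuous_on_eq_continuous_within by blast
    moreover have "{t \<in> {a..<b}. t \<le> T} = {a..T}" "{t \<in> {a..<b}. T \<le> t} \<subseteq> {T..b}"
      using T(1) \<delta>(1) by auto
    ultimately have "continuous_on {a..<b} \<eta>"
      unfolding \<eta>_def
      by (intro continuous_on_cases_le) (use \<delta> in \<open>auto intro: continuous_on_subset\<close>)
    moreover have "\<eta> a = z0" using \<gamma>(2) T(1) by (simp add: \<eta>_def)
    moreover have "g (\<eta> t) = p t" if "t \<in> {a..<b}" for t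
      using that \<gamma>(3)[of t] \<delta>(4)[of t] z(2) by (auto simp: \<eta>_def)
    ultimately have "partial_lift g p a z0 {a..<b} \<eta>"
      using T(1) \<delta>(1) by (intro partial_lift_atLeastLessThan) auto
    then have "(\<lambda>t. (t, \<eta> t)) ` {a..<b} \<in> ?A" by blast
    \<comment> \<open>The graph of \<eta> extends \<open>M\<close>, so maximality forces equality,
      although only the graph of \<eta> has a point over \<open>T\<close>.\<close>
    moreover have "M \<subseteq> (\<lambda>t. (t, \<eta> t)) ` {a..<b}"
      unfolding M_eq T(2) using \<delta>(1) by (auto simp: \<eta>_def)
    ultimately have "(\<lambda>t. (t, \<eta> t)) ` {a..<b} = M" using M(2) by blast
    moreover have "T \<in> {a..<b}" using T(1) \<delta>(1) by simp
    ultimately have "(T, \<eta> T) \<in> M" by blast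
    then have "T \<in> D" by (auto simp: M_eq)
    then show False using T(2) by simp
  qed
  then show thesis using that[of \<gamma>] D by (auto simp: partial_lift_def)
qed

section \<open>Asymptotic values of a composition\<close>

lemma AV_subset_AV_comp:
  assumes holg: "g holomorphic_on UNIV" and nonconst: "\<not> g constant_on UNIV"
    and bdd: "bounded (AV g)"
  shows "AV f \<subseteq> AV (f \<circ> g)"
proof
  fix \<zeta> assume "\<zeta> \<in> AV f"
  then have "asymptotic_value f \<zeta>" by (simp add: AV_def)
  then obtain \<Gamma> where "curve_to_infinity \<Gamma> \<and> ((\<lambda>t. f (\<Gamma> t)) \<longlongrightarrow> \<zeta>) at_top"
    unfolding asymptotic_value_def ..
  then have \<Gamma>: "continuous_on {0..} \<Gamma>" "filterlim \<Gamma> at_infinity at_top"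
      "((\<lambda>t. f (\<Gamma> t)) \<longlongrightarrow> \<zeta>) at_top"
    by (simp_all add: curve_to_infinity_def)
  have far: "\<exists>t0\<ge>0. \<forall>t\<ge>t0. norm (\<Gamma> t) > B" for B
  proof -
    have "filterlim (\<lambda>t. norm (\<Gamma> t)) at_top at_top"
      using \<Gamma>(2) filterlim_at_infinity_conv_norm_at_top by blast
    then obtain t where "\<And>s. s \<ge> t \<Longrightarrow> norm (\<Gamma> s) > B"
      unfolding filterlim_at_top_dense eventually_at_top_linorder by blast
    then show ?thesis
      by (intro exI[of _ "max t 0"]) auto
  qed
  obtain B where B: "\<And>w. w \<in> AV g \<Longrightarrow> norm w \<le> B"
    using bdd by (auto simp: bounded_iff)
  obtain t0 where t0: "t0 \<ge> 0" "\<And>t. t \<ge> t0 \<Longrightarrow> norm (\<Gamma> t) > B" using far by blast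
  \<comment> \<open>Two distinct values on the tail are needed: by little Picard a nonconstant
    entire function cannot omit both, so the tail can be started at one of them.\<close>
  obtain t1 where t1: "t1 \<ge> t0" "\<Gamma> t1 \<noteq> \<Gamma> t0"
    using far[of "norm (\<Gamma> t0)"] by (metis linorder_linear order_less_irrefl)
  have "range g \<inter> {\<Gamma> t0, \<Gamma> t1} \<noteq> {}"
  proof
    assume "range g \<inter> {\<Gamma> t0, \<Gamma> t1} = {}"
    then obtain c where "g = (\<lambda>x. c)" using little_Picard[OF holg] t1(2) by metis
    then show False using nonconst by (simp add: constant_on_def)
  qed
  then have "\<exists>a\<ge>t0. \<Gamma> a \<in> range g" using t1(1) by auto
  then obtain a z0 where a: "a \<ge> t0" "\<Gamma> a = g z0" by (elim exE conjE rangeE) metis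
  have "continuous_on {a..} \<Gamma>" using \<Gamma>(1) a(1) t0(1) by (auto intro: continuous_on_subset)
  moreover have "\<Gamma> t \<notin> AV g" if "t \<ge> a" for t
    using B[of "\<Gamma> t"] t0(2)[of t] a(1) that by force
  ultimately obtain \<gamma> where \<gamma>: "continuous_on {a..} \<gamma>" "\<And>t. t \<ge> a \<Longrightarrow> g (\<gamma> t) = \<Gamma> t"
    using entire_path_lift[OF holg nonconst] a(2) by metis
  \<comment> \<open>On the closed disc of radius \<open>R\<close> the function \<open>g\<close> is
    bounded by some \<open>C\<close>; once \<Gamma> has left the disc of radius \<open>C\<close>,
    its lift must be outside radius \<open>R\<close>.\<close>
  have "eventually (\<lambda>t. R < norm (\<gamma> t)) at_top" for R
  proof -
    have "compact (g ` cball 0 R)"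
      using holg by (intro compact_continuous_image holomorphic_on_imp_continuous_on)
        (auto intro: holomorphic_on_subset)
    then obtain C where "\<forall>w\<in>g ` cball 0 R. norm w \<le> C"
      using compact_imp_bounded[of "g ` cball 0 R"] unfolding bounded_iff by blast
    then have C: "norm (g z) \<le> C" if "norm z \<le> R" for z
      using that by simp
    obtain t2 where "\<And>t. t \<ge> t2 \<Longrightarrow> norm (\<Gamma> t) > C" using far by blast
    then have "R < norm (\<gamma> t)" if "t \<ge> max a t2" for t
      using that C[of "\<gamma> t"] \<gamma>(2)[of t] by (metis max.bounded_iff not_le)
    then show ?thesis unfolding eventually_at_top_linorder by blast
  qed
  then have inf: "filterlim \<gamma> at_infinity at_top"
    by (simp add: filterlim_at_infinity_conv_norm_at_top filterlim_at_top_dense)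
  \<comment> \<open>The lift lives on \<open>{a..}\<close>; translation by \<open>a\<close> moves
    its start to 0.\<close>
  have shift: "filterlim (\<lambda>s. a + s) at_top (at_top :: real filter)"
    by (rule filterlim_tendsto_add_at_top[OF tendsto_const filterlim_ident])
  have "continuous_on {0..} (\<lambda>s. \<gamma> (a + s))"
    by (intro continuous_on_compose2[OF \<gamma>(1)] continuous_intros) auto
  then have "curve_to_infinity (\<lambda>s. \<gamma> (a + s))"
    unfolding curve_to_infinity_def using filterlim_compose[OF inf shift] by blast
  moreover have "((\<lambda>s. f (\<Gamma> (a + s))) \<longlongrightarrow> \<zeta>) at_top"
    using filterlim_compose[OF \<Gamma>(3) shift] .
  then have "((\<lambda>s. (f \<circ> g) (\<gamma> (a + s))) \<longlongrightarrow> \<zeta>) at_top"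
    by (rule Lim_transform_eventually)
      (use \<gamma>(2) in \<open>auto intro: eventually_mono[OF eventually_ge_at_top[of 0]]\<close>)
  ultimately show "\<zeta> \<in> AV (f \<circ> g)"
    by (auto simp: AV_def asymptotic_value_def)
qed

theorem theorem2p3:
  fixes f g :: "complex \<Rightarrow> complex"
  assumes "transcendental_entire f"
    and "transcendental_entire g"
    and "bounded (AV (f \<circ> g))"
    and "bounded (AV g)"
  shows "bounded (AV f)"
proof -
  \<comment> \<open>Constants are polynomials, which transcendence excludes.\<close>
  have "\<not> g constant_on UNIV"
  proof
    assume "g constant_on UNIV"
    then obtain c where "\<And>z. g z = poly [:c:] z" by (auto simp: constant_on_def)
    then show False using assms(2) unfolding transcendental_entire_def by blast
  qed
  then have "AV f \<subseteq> AV (f \<circ> g)"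
    using AV_subset_AV_comp assms(2,4) unfolding transcendental_entire_def by blast
  then show ?thesis using assms(3) bounded_subset by blast
qed

end
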